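(* Let $h:\{0,1\}^n\to\{0,1\}$, $g:\{0,1\}\times\{0,1\}\to\{0,1\}$, and $f=h\circ g$, i.e. $f(x,y)=h(g(x_1,y_1),\dots,g(x_n,y_n))$ for $x,y\in\{0,1\}^n$; let $L_f(n)=\{x\#^ny: x,y\in\{0,1\}^n,\ f(x,y)=1\}$ over $\Sigma=\{0,1,\#\}$. Suppose there is a quantum query algorithm $\mathcal A$ computing $h$ with error $\epsilon$ that uses $k$ quantum basis states and $t$ queries. Then there exists a 2QCFA $M$ recognizing $L_f(n)$ with error $\epsilon$ that uses $2k$ quantum basis states and $O(tn)$ classical states, with $\mathrm{time}(M)=O(tn)$; hence $\mathrm{TS}(M)=O(tn(\log(tn)+\log 2k))$, which is $O(tn(\log n+\log k))$ when $t=O(n)$.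
   Context: Quantum query algorithm on input $z\in\{0,1\}^n$: starting from a fixed state in a $k$-dimensional space, it applies $U_tO_zU_{t-1}O_z\cdots U_1O_zU_0$ and measures, where $O_z|i,b,w\rangle=|i,b\oplus z_i,w\rangle$; it computes $h$ with error $\epsilon$ if the output equals $h(z)$ with probability $\ge1-\epsilon$ for every $z$. A 2QCFA reads $\vdash w\$$ with a head moving left/stay/right per step; it has a finite set of classical states (halting on accepting/rejecting ones) and a quantum register with basis set $Q$; in classical state $s$ reading $\sigma$ it either applies a unitary $\Theta(s,\sigma)$ and then makes the classical transition $\delta(s,\sigma)$, or performs an orthogonal measurement $\Theta(s,\sigma)$ and makes a classical transition depending on the outcome. It recognizes $L$ with error $\epsilon$ if members are accepted with probability $\ge1-\epsilon$ and non-members with probability $\le\epsilon$. $\mathrm{time}(M)$ = maximal number of steps before halting; $\mathrm{space}(M)=\log_2|Q|+\log_2(\#\text{classical states})$; $\mathrm{TS}(M)=\mathrm{time}(M)\mathrm{space}(M)$. *)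

theory Defs
  imports
    "Jordan_Normal_Form.Schur_Decomposition"
    "HOL-Library.Extended_Nat"
    "HOL-Library.Extended_Real"
begin

definition vnorm :: "complex vec \<Rightarrow> real" where
  "vnorm v = sqrt (\<Sum>j<dim_vec v. (cmod (v $ j))\<^sup>2)"

definition unitary :: "nat \<Rightarrow> complex mat \<Rightarrow> bool" where
  "unitary d U \<longleftrightarrow> U \<in> carrier_mat d d \<and>
     mat_adjoint U * U = 1\<^sub>m d \<and> U * mat_adjoint U = 1\<^sub>m d"

(* An orthogonal measurement is the list of its projectors; the outcomes are the list indices. *)
definition orth_measurement :: "nat \<Rightarrow> complex mat list \<Rightarrow> bool" where
  "orth_measurement d Ps \<longleftrightarrow>
     (\<forall>c<length Ps. Ps ! c \<in> carrier_mat d d \<and> mat_adjoint (Ps ! c) = Ps ! c) \<and>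
     (\<forall>c<length Ps. \<forall>c'<length Ps.
        Ps ! c * Ps ! c' = (if c = c' then Ps ! c else 0\<^sub>m d d)) \<and>
     foldr (+) Ps (0\<^sub>m d d) = 1\<^sub>m d"


section \<open>Quantum query algorithms\<close>

(* The j-th coordinate of the state space is the basis state |i,b,w> with basis_labels ! j = (i,b,w).
   Input bits are numbered from 0, i.e. z ! i for i < n; w is a label for the workspace part. *)
record query_alg =
  basis_labels :: "(nat \<times> bool \<times> nat) list"
  start :: "complex vec"
  unitaries :: "complex mat list"
  final_meas :: "complex mat list"
  out :: "nat \<Rightarrow> bool"

(* query_algorithm n k t A: on n input bits, with k basis states and t queries.
   Closure of the labels under flipping b says that queries map the state space to itself. *)
definition query_algorithm :: "nat \<Rightarrow> nat \<Rightarrow> nat \<Rightarrow> query_alg \<Rightarrow> bool" where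
  "query_algorithm n k t A \<longleftrightarrow>
     distinct (basis_labels A) \<and> length (basis_labels A) = k \<and>
     (\<forall>(i, b, w) \<in> set (basis_labels A). i < n \<and> (i, \<not> b, w) \<in> set (basis_labels A)) \<and>
     start A \<in> carrier_vec k \<and> vnorm (start A) = 1 \<and>
     length (unitaries A) = Suc t \<and> (\<forall>U \<in> set (unitaries A). unitary k U) \<and>
     orth_measurement k (final_meas A)"

definition query_label :: "bool list \<Rightarrow> nat \<times> bool \<times> nat \<Rightarrow> nat \<times> bool \<times> nat" where
  "query_label z = (\<lambda>(i, b, w). (i, b \<noteq> z ! i, w))"

definition query_mat :: "query_alg \<Rightarrow> bool list \<Rightarrow> complex mat" where
  "query_mat A z = (let B = basis_labels A; k = length B in
     mat k k (\<lambda>(r, c). if B ! r = query_label z (B ! c) then 1 else 0))"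

fun query_state :: "query_alg \<Rightarrow> bool list \<Rightarrow> nat \<Rightarrow> complex vec" where
  "query_state A z 0 = (unitaries A ! 0) *\<^sub>v start A"
| "query_state A z (Suc j) =
     (unitaries A ! Suc j) *\<^sub>v (query_mat A z *\<^sub>v query_state A z j)"

definition output_prob :: "query_alg \<Rightarrow> nat \<Rightarrow> bool list \<Rightarrow> bool \<Rightarrow> real" where
  "output_prob A t z b = (\<Sum>c | c < length (final_meas A) \<and> out A c = b.
     (vnorm (final_meas A ! c *\<^sub>v query_state A z t))\<^sup>2)"

definition computes :: "query_alg \<Rightarrow> nat \<Rightarrow> nat \<Rightarrow> (bool list \<Rightarrow> bool) \<Rightarrow> real \<Rightarrow> bool" where
  "computes A n t h \<epsilon> \<longleftrightarrow> (\<forall>z. length z = n \<longrightarrow> output_prob A t z (h z) \<ge> 1 - \<epsilon>)"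


section \<open>Two-way finite automata with quantum and classical states\<close>

datatype 'a cell = LEnd | Sym 'a | REnd
datatype move = MoveLeft | Stay | MoveRight
datatype qop = Unitary "complex mat" | Measure "complex mat list"

(* The quantum basis set is Q = {0..<qdim}. The classical transition is delta_u after a unitary
   and delta_m, with the outcome as last argument, after a measurement. *)
record ('s, 'a) qcfa =
  qdim :: nat
  qinit :: nat
  cstates :: "'s set"
  cinit :: 's
  acc :: "'s set"
  rej :: "'s set"
  theta :: "'s \<Rightarrow> 'a cell \<Rightarrow> qop"
  delta_u :: "'s \<Rightarrow> 'a cell \<Rightarrow> 's \<times> move"
  delta_m :: "'s \<Rightarrow> 'a cell \<Rightarrow> nat \<Rightarrow> 's \<times> move"

(* The head never leaves the part of the tape delimited by the end-markers. *)
definition legal_move :: "('s, 'a) qcfa \<Rightarrow> 'a cell \<Rightarrow> 's \<times> move \<Rightarrow> bool" where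
  "legal_move M \<sigma> = (\<lambda>(s, m). s \<in> cstates M \<and>
     \<not> (\<sigma> = LEnd \<and> m = MoveLeft) \<and> \<not> (\<sigma> = REnd \<and> m = MoveRight))"

definition is_2qcfa :: "('s, 'a) qcfa \<Rightarrow> bool" where
  "is_2qcfa M \<longleftrightarrow> qinit M < qdim M \<and>
     finite (cstates M) \<and> cinit M \<in> cstates M \<and>
     acc M \<subseteq> cstates M \<and> rej M \<subseteq> cstates M \<and> acc M \<inter> rej M = {} \<and>
     (\<forall>s \<in> cstates M - (acc M \<union> rej M). \<forall>\<sigma>.
        case theta M s \<sigma> of
          Unitary U \<Rightarrow> unitary (qdim M) U \<and> legal_move M \<sigma> (delta_u M s \<sigma>)
        | Measure Ps \<Rightarrow> orth_measurement (qdim M) Ps \<and>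
            (\<forall>c<length Ps. legal_move M \<sigma> (delta_m M s \<sigma> c)))"

definition tape :: "'a list \<Rightarrow> 'a cell list" where
  "tape w = LEnd # map Sym w @ [REnd]"

fun move_head :: "nat \<Rightarrow> move \<Rightarrow> nat" where
  "move_head p MoveLeft = p - 1"
| "move_head p Stay = p"
| "move_head p MoveRight = p + 1"

(* classical state, head position on the tape, quantum state *)
type_synonym 's config = "'s \<times> nat \<times> complex vec"

definition init_config :: "('s, 'a) qcfa \<Rightarrow> 's config" where
  "init_config M = (cinit M, 0, unit_vec (qdim M) (qinit M))"

(* Successor configurations with their probabilities. For an outcome of probability 0 the
   normalised vector is meaningless; such entries carry weight 0 and are not steps. *)
definition successors :: "('s, 'a) qcfa \<Rightarrow> 'a list \<Rightarrow> 's config \<Rightarrow> (real \<times> 's config) list" where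
  "successors M w = (\<lambda>(s, p, \<psi>).
     if s \<in> acc M \<union> rej M then [] else
     (let \<sigma> = tape w ! p in
      case theta M s \<sigma> of
        Unitary U \<Rightarrow>
          (case delta_u M s \<sigma> of (s', m) \<Rightarrow> [(1, s', move_head p m, U *\<^sub>v \<psi>)])
      | Measure Ps \<Rightarrow>
          map (\<lambda>c. case delta_m M s \<sigma> c of (s', m) \<Rightarrow>
                 (let \<phi> = Ps ! c *\<^sub>v \<psi> in
                   ((vnorm \<phi>)\<^sup>2, s', move_head p m, complex_of_real (1 / vnorm \<phi>) \<cdot>\<^sub>v \<phi>)))
            [0..<length Ps]))"

fun accept_within :: "('s, 'a) qcfa \<Rightarrow> 'a list \<Rightarrow> nat \<Rightarrow> 's config \<Rightarrow> real" where
  "accept_within M w 0 c = (if fst c \<in> acc M then 1 else 0)"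
| "accept_within M w (Suc T) c = (if fst c \<in> acc M then 1 else
     (\<Sum>(r, c') \<leftarrow> successors M w c. r * accept_within M w T c'))"

definition accept_prob :: "('s, 'a) qcfa \<Rightarrow> 'a list \<Rightarrow> real" where
  "accept_prob M w = (SUP T. accept_within M w T (init_config M))"

definition recognizes :: "('s, 'a) qcfa \<Rightarrow> 'a list set \<Rightarrow> real \<Rightarrow> bool" where
  "recognizes M L \<epsilon> \<longleftrightarrow>
     (\<forall>w \<in> L. accept_prob M w \<ge> 1 - \<epsilon>) \<and> (\<forall>w. w \<notin> L \<longrightarrow> accept_prob M w \<le> \<epsilon>)"

definition step :: "('s, 'a) qcfa \<Rightarrow> 'a list \<Rightarrow> ('s config \<times> 's config) set" where
  "step M w = {(c, c'). \<exists>r > 0. (r, c') \<in> set (successors M w c)}"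

(* Supremum over all inputs and all computation branches of positive probability. *)
definition run_time :: "('s, 'a) qcfa \<Rightarrow> enat" where
  "run_time M = Sup {enat j | j. \<exists>w c. (init_config M, c) \<in> step M w ^^ j}"

definition space :: "('s, 'a) qcfa \<Rightarrow> real" where
  "space M = log 2 (real (qdim M)) + log 2 (real (card (cstates M)))"

definition TS :: "('s, 'a) qcfa \<Rightarrow> ereal" where
  "TS M = ereal_of_enat (run_time M) * ereal (space M)"


section \<open>The language of a composed function\<close>

datatype sym = Zero | One | Hash

definition bit :: "bool \<Rightarrow> sym" where
  "bit b = (if b then One else Zero)"

definition compose_bitwise ::
  "(bool list \<Rightarrow> bool) \<Rightarrow> (bool \<Rightarrow> bool \<Rightarrow> bool) \<Rightarrow> bool list \<Rightarrow> bool list \<Rightarrow> bool" where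
  "compose_bitwise h g x y = h (map2 g x y)"

definition L_lang :: "(bool list \<Rightarrow> bool list \<Rightarrow> bool) \<Rightarrow> nat \<Rightarrow> sym list set" where
  "L_lang f n = {map bit x @ replicate n Hash @ map bit y | x y.
     length x = n \<and> length y = n \<and> f x y}"

end

theory Submission
  imports Defs
begin

text \<open>
  The automaton is oblivious. Its classical state is a step counter, and the head sweeps over the
  \<open>3 * n + 2\<close> cells of a well-formed tape back and forth, one double sweep per query, so that the
  counter determines where the head should be. Comparing the kind of the scanned cell with the
  one expected there makes every malformed input be rejected during the first double sweep.

  The quantum register is that of the query algorithm with one ancilla qubit. On the part of the
  state with query index \<open>i\<close>, the way right adds \<open>x ! i\<close> to the ancilla and then \<open>g\<close> of the ancilla
  and \<open>y ! i\<close> to the answer bit; the way left uncomputes the ancilla. All these maps permute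
  the basis and depend only on the scanned symbol. At the left end the next unitary of the query
  algorithm is applied, and finally its measurement.
\<close>

section \<open>Adjoints, unitaries and measurements\<close>

lemma mat_adjoint_carrier [simp]:
  "A \<in> carrier_mat m n \<Longrightarrow> mat_adjoint A \<in> carrier_mat n m"
  by (auto simp: mat_adjoint_def)

lemma dim_mat_adjoint [simp]:
  "dim_row (mat_adjoint A) = dim_col A" "dim_col (mat_adjoint A) = dim_row A"
  by (auto simp: mat_adjoint_def)

lemma index_mat_adjoint [simp]:
  fixes A :: "complex mat"
  assumes "i < dim_col A" "j < dim_row A"
  shows "mat_adjoint A $$ (i, j) = cnj (A $$ (j, i))"
  using assms by (simp add: mat_adjoint_def mat_of_rows_def)

lemma mat_adjoint_mult:
  fixes A B :: "complex mat"
  assumes "A \<in> carrier_mat m n" "B \<in> carrier_mat n l"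
  shows "mat_adjoint (A * B) = mat_adjoint B * mat_adjoint A"
  using assms
  by (intro eq_matI) (auto simp: scalar_prod_def cnj_sum mult.commute intro!: sum.cong)

lemma cscalar_prod_mult_mat_vec:
  fixes A :: "complex mat"
  assumes "A \<in> carrier_mat m n" "v \<in> carrier_vec n" "w \<in> carrier_vec m"
  shows "(A *\<^sub>v v) \<bullet>c w = v \<bullet>c (mat_adjoint A *\<^sub>v w)"
proof -
  have "(A *\<^sub>v v) \<bullet>c w = (\<Sum>i<m. \<Sum>j<n. A $$ (i, j) * v $ j * cnj (w $ i))"
    using assms by (simp add: scalar_prod_def sum_distrib_right lessThan_atLeast0)
  also have "\<dots> = (\<Sum>j<n. \<Sum>i<m. A $$ (i, j) * v $ j * cnj (w $ i))"
    by (rule sum.swap)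
  also have "\<dots> = v \<bullet>c (mat_adjoint A *\<^sub>v w)"
    using assms
    by (simp add: scalar_prod_def sum_distrib_left lessThan_atLeast0 cnj_sum mult_ac)
  finally show ?thesis .
qed

text \<open>Links the real norm to the inner product: the norm identities below are proved over the
  complex numbers and pulled back along the injective \<open>complex_of_real\<close>.\<close>

lemma vnorm_square: "complex_of_real ((vnorm v)\<^sup>2) = v \<bullet>c v"
proof -
  have "complex_of_real ((vnorm v)\<^sup>2) = (\<Sum>j<dim_vec v. complex_of_real ((cmod (v $ j))\<^sup>2))"
    by (simp add: vnorm_def sum_nonneg)
  also have "\<dots> = v \<bullet>c v"
    by (simp only: scalar_prod_def complex_norm_square lessThan_atLeast0) simp
  finally show ?thesis .
qed

lemma unitaryI:
  assumes "U \<in> carrier_mat d d" "mat_adjoint U * U = 1\<^sub>m d"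
  shows "unitary d U"
  using assms mat_mult_left_right_inverse[of "mat_adjoint U" d U]
  by (simp add: unitary_def)

lemma unitary_mult:
  assumes "unitary d U" "unitary d V"
  shows "unitary d (U * V)"
proof (rule unitaryI)
  have c: "U \<in> carrier_mat d d" "V \<in> carrier_mat d d"
      "mat_adjoint U \<in> carrier_mat d d" "mat_adjoint V \<in> carrier_mat d d"
    using assms by (auto simp: unitary_def)
  then show "U * V \<in> carrier_mat d d" by simp
  have "mat_adjoint (U * V) * (U * V) = mat_adjoint V * (mat_adjoint U * U) * V"
    using c by (simp add: mat_adjoint_mult[of _ d d _ d] assoc_mult_mat[of _ d d _ d _ d]
        mult_carrier_mat[of _ d d _ d])
  then show "mat_adjoint (U * V) * (U * V) = 1\<^sub>m d"
    using assms c by (simp add: unitary_def)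
qed

lemma vnorm_unitary:
  assumes "unitary d U" "v \<in> carrier_vec d"
  shows "vnorm (U *\<^sub>v v) = vnorm v"
proof -
  have U: "U \<in> carrier_mat d d" using assms by (simp add: unitary_def)
  have "complex_of_real ((vnorm (U *\<^sub>v v))\<^sup>2) = v \<bullet>c ((mat_adjoint U * U) *\<^sub>v v)"
    using U assms(2) by (simp only: vnorm_square cscalar_prod_mult_mat_vec[of _ d d]
        mult_mat_vec_carrier[of _ d d] assoc_mult_mat_vec[of _ d d _ d] mat_adjoint_carrier)
  also have "\<dots> = complex_of_real ((vnorm v)\<^sup>2)"
    using assms by (simp only: vnorm_square unitary_def one_mult_mat_vec)
  finally have "(vnorm (U *\<^sub>v v))\<^sup>2 = (vnorm v)\<^sup>2" by (simp only: of_real_eq_iff)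
  then show ?thesis by (simp add: vnorm_def sum_nonneg)
qed

lemma foldr_add_mat_carrier:
  "(\<And>P. P \<in> set Ps \<Longrightarrow> P \<in> carrier_mat d d) \<Longrightarrow> foldr (+) Ps (0\<^sub>m d d) \<in> carrier_mat d d"
  by (induction Ps) auto

lemma cscalar_prod_foldr_add:
  fixes v :: "complex vec"
  assumes "\<And>P. P \<in> set Ps \<Longrightarrow> P \<in> carrier_mat d d" "v \<in> carrier_vec d"
  shows "(foldr (+) Ps (0\<^sub>m d d) *\<^sub>v v) \<bullet>c v = (\<Sum>P\<leftarrow>Ps. (P *\<^sub>v v) \<bullet>c v)"
  using assms(1)
proof (induction Ps)
  case Nil
  have "0\<^sub>m d d *\<^sub>v v = 0\<^sub>v d" using assms(2) by (intro eq_vecI) (auto simp: scalar_prod_def)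
  then show ?case using assms(2) by (simp add: scalar_prod_def)
next
  case (Cons P Ps)
  have c: "P \<in> carrier_mat d d" "foldr (+) Ps (0\<^sub>m d d) \<in> carrier_mat d d"
    using Cons.prems foldr_add_mat_carrier[of Ps d] by auto
  have "foldr (+) (P # Ps) (0\<^sub>m d d) *\<^sub>v v = P *\<^sub>v v + foldr (+) Ps (0\<^sub>m d d) *\<^sub>v v"
    using add_mult_distrib_mat_vec[OF c assms(2)] by simp
  moreover have "(P *\<^sub>v v + foldr (+) Ps (0\<^sub>m d d) *\<^sub>v v) \<bullet>c v
      = (P *\<^sub>v v) \<bullet>c v + (foldr (+) Ps (0\<^sub>m d d) *\<^sub>v v) \<bullet>c v"
    using c assms(2) by (intro add_scalar_prod_distrib[of _ d]) auto
  ultimately show ?case using Cons by simp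
qed

text \<open>A projector is self-adjoint and idempotent, so the squared norm of the projected vector
  is its inner product with \<open>v\<close>. These inner products add up to that of
  \<open>v\<close> with itself, since the projectors sum to the identity.\<close>

lemma orth_measurement_total:
  assumes "orth_measurement d Ps" "v \<in> carrier_vec d"
  shows "(\<Sum>c<length Ps. (vnorm (Ps ! c *\<^sub>v v))\<^sup>2) = (vnorm v)\<^sup>2"
proof -
  have P: "Ps ! c \<in> carrier_mat d d" "mat_adjoint (Ps ! c) = Ps ! c" "Ps ! c * Ps ! c = Ps ! c"
    if "c < length Ps" for c
    using assms that by (auto simp: orth_measurement_def)
  have c: "P \<in> carrier_mat d d" if "P \<in> set Ps" for P
    using that P by (auto simp: in_set_conv_nth)
  have "complex_of_real ((vnorm (Ps ! c *\<^sub>v v))\<^sup>2) = (Ps ! c *\<^sub>v v) \<bullet>c v"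
    if "c < length Ps" for c
  proof -
    note P = P[OF that]
    have "(Ps ! c *\<^sub>v v) \<bullet>c v = ((Ps ! c * Ps ! c) *\<^sub>v v) \<bullet>c v" using P by simp
    also have "\<dots> = (Ps ! c *\<^sub>v v) \<bullet>c (Ps ! c *\<^sub>v v)"
      using cscalar_prod_mult_mat_vec[of "Ps ! c" d d "Ps ! c *\<^sub>v v" v]
        assoc_mult_mat_vec[OF P(1) P(1) assms(2)] P assms(2)
      by simp
    finally show ?thesis by (simp only: vnorm_square)
  qed
  then have "complex_of_real (\<Sum>c<length Ps. (vnorm (Ps ! c *\<^sub>v v))\<^sup>2)
      = (\<Sum>c<length Ps. (Ps ! c *\<^sub>v v) \<bullet>c v)"
    by (simp only: of_real_sum) simp
  also have "\<dots> = (foldr (+) Ps (0\<^sub>m d d) *\<^sub>v v) \<bullet>c v"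
    using cscalar_prod_foldr_add[of Ps d v] c assms(2)
    by (simp add: sum_list_sum_nth lessThan_atLeast0)
  also have "\<dots> = complex_of_real ((vnorm v)\<^sup>2)"
    using assms by (simp only: vnorm_square orth_measurement_def one_mult_mat_vec)
  finally show ?thesis by (simp only: of_real_eq_iff)
qed

text \<open>Complete \<open>v\<close> to a basis, orthogonalise by Gram-Schmidt, which keeps the
  first vector, and take the normalised vectors as columns. Such a unitary prepares a start vector
  from a basis state.\<close>

lemma exists_unitary_first_column:
  fixes v :: "complex vec"
  assumes v: "v \<in> carrier_vec d" and nv: "vnorm v = 1"
  shows "\<exists>W. unitary d W \<and> W *\<^sub>v unit_vec d 0 = v"
proof -
  have v0: "v \<noteq> 0\<^sub>v d" using nv by (auto simp: vnorm_def)
  have d0: "0 < d" using v v0 by (cases d) (auto intro!: eq_vecI)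
  interpret cof_vec_space d "TYPE(complex)" .
  note B = basis_completion[OF v v0]
  define ws where "ws = gram_schmidt d (basis_completion v)"
  have ws: "set ws \<subseteq> carrier_vec d" "corthogonal ws" "length ws = d"
    using gram_schmidt_result[OF B(2,4,5) refl, folded ws_def] B(6) by auto
  have hd_ws: "ws ! 0 = v"
  proof -
    obtain vs where "basis_completion v = v # vs"
      using B(6,7) d0 by (cases "basis_completion v") auto
    then have "hd ws = v" using gram_schmidt_hd[OF v, of vs] by (simp add: ws_def)
    then show ?thesis using ws(3) d0 by (cases ws) auto
  qed
  have w: "ws ! i \<in> carrier_vec d" if "i < d" for i using ws that by auto
  \<comment> \<open>Gram-Schmidt only orthogonalises here. The scaling factors are real, so
    conjugation leaves them alone; the first one is 1, as \<open>v\<close> is a unit vector.\<close>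
  define a where "a i = complex_of_real (1 / vnorm (ws ! i))" for i
  define W where "W = mat_of_cols d (map (\<lambda>i. a i \<cdot>\<^sub>v ws ! i) [0..<d])"
  have W: "W \<in> carrier_mat d d" by (auto simp: W_def mat_of_cols_def)
  have col: "col W i = a i \<cdot>\<^sub>v ws ! i" if "i < d" for i
    using that w[OF that] by (simp add: W_def)
  have a: "(ws ! i) \<bullet>c (ws ! i) * (a i * a i) = 1" if "i < d" for i
  proof -
    have "(ws ! i) \<bullet>c (ws ! i) \<noteq> 0" using corthogonalD[OF ws(2)] that ws(3) by auto
    then have "vnorm (ws ! i) \<noteq> 0" by (auto simp flip: vnorm_square)
    then show ?thesis
      by (simp add: a_def power2_eq_square flip: vnorm_square)
  qed
  have "mat_adjoint W * W = 1\<^sub>m d"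
  proof (intro eq_matI)
    fix i j assume "i < dim_row (1\<^sub>m d :: complex mat)" "j < dim_col (1\<^sub>m d :: complex mat)"
    then have ij: "i < d" "j < d" by auto
    have "(mat_adjoint W * W) $$ (i, j) = conjugate (col W i) \<bullet> col W j"
      using W ij by (simp add: mat_adjoint_def)
    also have "\<dots> = (a j \<cdot>\<^sub>v ws ! j) \<bullet>c (a i \<cdot>\<^sub>v ws ! i)"
      using ij w by (simp add: col comm_scalar_prod[of _ d])
    also have "\<dots> = (ws ! j) \<bullet>c (ws ! i) * (a j * a i)"
    proof -
      have "ws ! j \<in> carrier_vec d" "conjugate (ws ! i) \<in> carrier_vec d" using ij w by auto
      then show ?thesis by (simp add: conjugate_smult_vec a_def smult_scalar_prod_distrib[of _ d]
            scalar_prod_smult_distrib[of _ d])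
    qed
    also have "\<dots> = 1\<^sub>m d $$ (i, j)"
      using a[of i] corthogonalD[OF ws(2), of j i] ij ws(3) by auto
    finally show "(mat_adjoint W * W) $$ (i, j) = 1\<^sub>m d $$ (i, j)" .
  qed (use W in auto)
  then have "unitary d W" using W by (rule unitaryI[rotated])
  moreover have "W *\<^sub>v unit_vec d 0 = v"
  proof -
    have "W *\<^sub>v unit_vec d 0 = col W 0" using W d0 by (intro eq_vecI) auto
    also have "\<dots> = v" using d0 hd_ws nv by (simp add: col a_def)
    finally show ?thesis .
  qed
  ultimately show ?thesis by blast
qed

section \<open>Adjoining an ancilla qubit\<close>

text \<open>The tensor product of the identity on the ancilla with \<open>A\<close>, in block
  form.\<close>

definition with_ancilla :: "complex mat \<Rightarrow> complex mat" where
  "with_ancilla A = four_block_mat A (0\<^sub>m (dim_row A) (dim_col A)) (0\<^sub>m (dim_row A) (dim_col A)) A"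

lemma with_ancilla_carrier:
  "A \<in> carrier_mat d d \<Longrightarrow> with_ancilla A \<in> carrier_mat (2 * d) (2 * d)"
  by (auto simp: with_ancilla_def)

lemma with_ancilla_adjoint:
  "A \<in> carrier_mat d d \<Longrightarrow> mat_adjoint (with_ancilla A) = with_ancilla (mat_adjoint A)"
  by (intro eq_matI) (auto simp: with_ancilla_def)

lemma with_ancilla_mult:
  "A \<in> carrier_mat d d \<Longrightarrow> B \<in> carrier_mat d d \<Longrightarrow>
    with_ancilla A * with_ancilla B = with_ancilla (A * B)"
  by (auto simp: with_ancilla_def mult_four_block_mat[of _ d d _ d _ d _ _ d _ d])

lemma with_ancilla_add:
  "A \<in> carrier_mat d d \<Longrightarrow> B \<in> carrier_mat d d \<Longrightarrow>
    with_ancilla A + with_ancilla B = with_ancilla (A + B)"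
  by (auto simp: with_ancilla_def add_four_block_mat[of _ d d _ d _ d])

lemma with_ancilla_one: "with_ancilla (1\<^sub>m d) = 1\<^sub>m (2 * d)"
  by (simp add: with_ancilla_def mult_2)

lemma with_ancilla_zero: "with_ancilla (0\<^sub>m d d) = 0\<^sub>m (2 * d) (2 * d)"
  by (simp add: with_ancilla_def mult_2)

lemma with_ancilla_mult_vec:
  assumes "A \<in> carrier_mat d d" "v \<in> carrier_vec d"
  shows "with_ancilla A *\<^sub>v (v @\<^sub>v 0\<^sub>v d) = (A *\<^sub>v v) @\<^sub>v 0\<^sub>v d"
proof -
  have "A *\<^sub>v 0\<^sub>v d = 0\<^sub>v d" using assms(1) by (intro eq_vecI) (auto simp: scalar_prod_def)
  then show ?thesis
    using assms mult_mat_vec_split[OF assms(1) assms(1) assms(2), of "0\<^sub>v d"]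
    by (simp add: with_ancilla_def)
qed

lemma vnorm_append_zero: "vnorm (v @\<^sub>v 0\<^sub>v d) = vnorm v"
proof -
  have "(\<Sum>j<dim_vec v + d. (cmod ((v @\<^sub>v 0\<^sub>v d) $ j))\<^sup>2) = (\<Sum>j<dim_vec v. (cmod (v $ j))\<^sup>2)"
    by (rule sum.mono_neutral_cong_right) auto
  then show ?thesis by (simp add: vnorm_def)
qed

lemma unitary_with_ancilla:
  assumes "unitary d U"
  shows "unitary (2 * d) (with_ancilla U)"
  using assms
  by (simp add: unitary_def with_ancilla_carrier with_ancilla_adjoint[of _ d]
      with_ancilla_mult[of _ d] with_ancilla_one)

text \<open>\<open>with_ancilla\<close> preserves sums, products, adjoints, zero and identity, so
  every clause of the definition carries over.\<close>

lemma orth_measurement_with_ancilla: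
  assumes "orth_measurement d Ps"
  shows "orth_measurement (2 * d) (map with_ancilla Ps)"
proof -
  have P: "Ps ! c \<in> carrier_mat d d" "mat_adjoint (Ps ! c) = Ps ! c" if "c < length Ps" for c
    using assms that by (auto simp: orth_measurement_def)
  have PP: "Ps ! c * Ps ! c' = (if c = c' then Ps ! c else 0\<^sub>m d d)"
    if "c < length Ps" "c' < length Ps" for c c'
    using assms that by (auto simp: orth_measurement_def)
  have "\<forall>P\<in>set Ps. P \<in> carrier_mat d d"
    using P by (auto simp: in_set_conv_nth)
  then have "foldr (+) (map with_ancilla Ps) (0\<^sub>m (2 * d) (2 * d))
      = with_ancilla (foldr (+) Ps (0\<^sub>m d d))"
  proof (induction Ps)
    case (Cons P Ps)
    then show ?case by (simp add: with_ancilla_add[of _ d] foldr_add_mat_carrier)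
  qed (simp add: with_ancilla_zero)
  moreover have "foldr (+) Ps (0\<^sub>m d d) = 1\<^sub>m d"
    using assms by (simp add: orth_measurement_def)
  ultimately have sum: "foldr (+) (map with_ancilla Ps) (0\<^sub>m (2 * d) (2 * d)) = 1\<^sub>m (2 * d)"
    by (simp add: with_ancilla_one)
  have "with_ancilla (Ps ! c) * with_ancilla (Ps ! c')
      = (if c = c' then with_ancilla (Ps ! c) else 0\<^sub>m (2 * d) (2 * d))"
    if "c < length Ps" "c' < length Ps" for c c'
    using PP[OF that] P that by (simp add: with_ancilla_mult[of _ d] with_ancilla_zero)
  moreover have "mat_adjoint (with_ancilla (Ps ! c)) = with_ancilla (Ps ! c)"
    if "c < length Ps" for c
    using P[OF that] by (simp add: with_ancilla_adjoint[of _ d])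
  ultimately show ?thesis
    using P sum by (simp add: orth_measurement_def with_ancilla_carrier)
qed

section \<open>Permutations of the basis labels\<close>

text \<open>The permutation matrix of \<open>p\<close> when coordinate \<open>r\<close> carries the
  label \<open>dec r\<close>. An abstract \<open>dec\<close> covers both the labels of the query
  algorithm and those with an ancilla bit.\<close>

definition relabel_mat :: "nat \<Rightarrow> (nat \<Rightarrow> 'l) \<Rightarrow> ('l \<Rightarrow> 'l) \<Rightarrow> complex mat" where
  "relabel_mat d dec p = mat d d (\<lambda>(r, c). if dec r = p (dec c) then 1 else 0)"

text \<open>As \<open>p\<close> is its own inverse, the only nonzero entry of row \<open>r\<close>
  is in the column labelled \<open>p (dec r)\<close>. A permutation of the basis thus becomes a
  substitution in the amplitude function \<open>F\<close>.\<close>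

lemma relabel_mat_mult_vec:
  assumes dec: "bij_betw dec {..<d} S" and p: "\<And>x. x \<in> S \<Longrightarrow> p x \<in> S \<and> p (p x) = x"
  shows "relabel_mat d dec p *\<^sub>v vec d (\<lambda>r. F (dec r)) = vec d (\<lambda>r. F (p (dec r)))"
proof (intro eq_vecI)
  fix r assume "r < dim_vec (vec d (\<lambda>r. F (p (dec r))))"
  then have r: "r < d" by simp
  then have "p (dec r) \<in> S" using p bij_betwE[OF dec] by auto
  then obtain c0 where c0: "c0 < d" "dec c0 = p (dec r)"
    using dec by (metis bij_betw_imp_surj_on imageE lessThan_iff)
  have eq: "dec r = p (dec c) \<longleftrightarrow> c = c0" if "c < d" for c
    using c0 r that p bij_betwE[OF dec] bij_betw_imp_inj_on[OF dec]
    by (metis inj_onD lessThan_iff)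
  have "(relabel_mat d dec p *\<^sub>v vec d (\<lambda>r. F (dec r))) $ r
      = (\<Sum>c<d. (if dec r = p (dec c) then 1 else 0) * F (dec c))"
    using r by (simp add: relabel_mat_def scalar_prod_def lessThan_atLeast0)
  also have "\<dots> = (\<Sum>c<d. if c = c0 then F (dec c) else 0)"
    using eq by (intro sum.cong) auto
  also have "\<dots> = F (p (dec r))" using c0 by simp
  finally show "(relabel_mat d dec p *\<^sub>v vec d (\<lambda>r. F (dec r))) $ r
      = vec d (\<lambda>r. F (p (dec r))) $ r" using r by simp
qed (simp add: relabel_mat_def)

text \<open>The matrix is real, and symmetric because \<open>p\<close> is an involution; hence it is
  its own adjoint and its own inverse.\<close>

lemma unitary_relabel_mat:
  assumes dec: "bij_betw dec {..<d} S" and p: "\<And>x. x \<in> S \<Longrightarrow> p x \<in> S \<and> p (p x) = x"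
  shows "unitary d (relabel_mat d dec p)"
proof (rule unitaryI)
  show c: "relabel_mat d dec p \<in> carrier_mat d d" by (simp add: relabel_mat_def)
  have S: "dec r \<in> S" if "r < d" for r using bij_betwE[OF dec] that by auto
  have inj: "dec r = dec c \<longleftrightarrow> r = c" if "r < d" "c < d" for r c
    using bij_betw_imp_inj_on[OF dec] that by (auto dest: inj_onD)
  have adj: "mat_adjoint (relabel_mat d dec p) = relabel_mat d dec p"
  proof (intro eq_matI)
    fix r c assume "r < dim_row (relabel_mat d dec p)" "c < dim_col (relabel_mat d dec p)"
    then have rc: "r < d" "c < d" by (auto simp: relabel_mat_def)
    have "dec r = p (dec c) \<longleftrightarrow> dec c = p (dec r)" using p S rc by metis
    then show "mat_adjoint (relabel_mat d dec p) $$ (r, c) = relabel_mat d dec p $$ (r, c)"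
      using rc by (simp add: relabel_mat_def)
  qed (auto simp: relabel_mat_def)
  have "relabel_mat d dec p * relabel_mat d dec p = 1\<^sub>m d"
  proof (intro eq_matI)
    fix r c assume "r < dim_row (1\<^sub>m d :: complex mat)" "c < dim_col (1\<^sub>m d :: complex mat)"
    then have rc: "r < d" "c < d" by auto
    \<comment> \<open>The amplitude function of column \<open>c\<close>, so that the matrix product
      is one more substitution of \<open>p\<close>.\<close>
    let ?F = "\<lambda>l. if l = p (dec c) then 1 else 0 :: complex"
    have "(relabel_mat d dec p * relabel_mat d dec p) $$ (r, c)
        = (relabel_mat d dec p *\<^sub>v vec d (\<lambda>r. ?F (dec r))) $ r"
      using rc by (simp add: relabel_mat_def scalar_prod_def)
    also have "\<dots> = ?F (p (dec r))" using rc by (simp only: relabel_mat_mult_vec[OF dec p, of ?F]) simp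
    also have "\<dots> = 1\<^sub>m d $$ (r, c)" using rc p S inj by (metis index_one_mat(1))
    finally show "(relabel_mat d dec p * relabel_mat d dec p) $$ (r, c) = 1\<^sub>m d $$ (r, c)" .
  qed (auto simp: relabel_mat_def)
  then show "mat_adjoint (relabel_mat d dec p) * relabel_mat d dec p = 1\<^sub>m d"
    by (simp add: adj)
qed

lemma query_mat_eq_relabel_mat:
  "query_mat A z = relabel_mat (length (basis_labels A)) ((!) (basis_labels A)) (query_label z)"
  by (simp add: query_mat_def relabel_mat_def Let_def)

(* Basis state r of the doubled register: the first half has the ancilla bit 0. *)
definition joint_label :: "'l list \<Rightarrow> nat \<Rightarrow> bool \<times> 'l" where
  "joint_label B r = (length B \<le> r, B ! (r mod length B))"

lemma bij_betw_joint_label: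
  assumes "distinct B"
  shows "bij_betw (joint_label B) {..<2 * length B} (UNIV \<times> set B)"
proof (intro bij_betw_imageI)
  show "inj_on (joint_label B) {..<2 * length B}"
  proof (rule inj_onI)
    fix r r' assume r: "r \<in> {..<2 * length B}" "r' \<in> {..<2 * length B}"
      and eq: "joint_label B r = joint_label B r'"
    have split: "s = s mod length B + (if length B \<le> s then length B else 0)"
      if "s < 2 * length B" for s
      using that by (simp add: le_mod_geq)
    have "length B > 0" using r by auto
    then have "r mod length B = r' mod length B"
      using eq assms by (auto simp: joint_label_def nth_eq_iff_index_eq)
    then show "r = r'" using split[of r] split[of r'] r eq by (simp add: joint_label_def)
  qed
  show "joint_label B ` {..<2 * length B} = UNIV \<times> set B"
  proof (intro equalityI subsetI)
    fix al assume "al \<in> (UNIV :: bool set) \<times> set B"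
    then obtain a c where al: "al = (a, B ! c)" "c < length B"
      by (auto simp: in_set_conv_nth)
    then have "joint_label B (if a then length B + c else c) = al"
      by (simp add: joint_label_def)
    moreover have "(if a then length B + c else c) < 2 * length B" using al by auto
    ultimately show "al \<in> joint_label B ` {..<2 * length B}" by (metis imageI lessThan_iff)
  next
    fix al assume "al \<in> joint_label B ` {..<2 * length B}"
    then obtain r where "r < 2 * length B" "al = joint_label B r" by auto
    moreover then have "length B > 0" by auto
    ultimately show "al \<in> UNIV \<times> set B" by (simp add: joint_label_def)
  qed
qed

text \<open>Connects the sweep invariant, which speaks of labels, with the block matrices, which act
  on padded vectors.\<close>

lemma joint_label_vec:
  "vec (2 * length B) (\<lambda>r. case joint_label B r of (a, l) \<Rightarrow> if a then 0 else G l)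
    = vec (length B) (\<lambda>r. G (B ! r)) @\<^sub>v 0\<^sub>v (length B)"
  by (intro eq_vecI) (auto simp: joint_label_def)

section \<open>Double sweeps over the tape\<close>

(* The number of steps in which the head runs over the 3 n + 2 tape cells and back. *)
definition period :: "nat \<Rightarrow> nat" where
  "period n = 6 * n + 2"

text \<open>A triangular wave: in one period each end-marker is visited once and every other cell
  twice.\<close>

definition head_pos :: "nat \<Rightarrow> nat \<Rightarrow> nat" where
  "head_pos n \<tau> = (if \<tau> \<le> 3 * n + 1 then \<tau> else 6 * n + 2 - \<tau>)"

text \<open>The shape test that exposes malformed inputs. It looks only at the kind of a cell and
  leaves the bits of \<open>x\<close> and \<open>y\<close> free.\<close>

definition fits :: "nat \<Rightarrow> nat \<Rightarrow> sym cell \<Rightarrow> bool" where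
  "fits n p \<sigma> = (case \<sigma> of LEnd \<Rightarrow> p = 0 | REnd \<Rightarrow> p = 3 * n + 1
    | Sym a \<Rightarrow> if a = Hash then n < p \<and> p \<le> 2 * n
        else 1 \<le> p \<and> p \<le> n \<or> 2 * n < p \<and> p \<le> 3 * n)"

definition word :: "bool list \<Rightarrow> bool list \<Rightarrow> sym list" where
  "word x y = map bit x @ replicate (length x) Hash @ map bit y"

lemma tape_nth [simp]:
  "tape w ! 0 = LEnd"
  "i < length w \<Longrightarrow> tape w ! Suc i = Sym (w ! i)"
  "tape w ! Suc (length w) = REnd"
  by (auto simp: tape_def nth_append)

lemma tape_word:
  assumes "length x = n" "length y = n"
  shows "i < n \<Longrightarrow> tape (word x y) ! Suc i = Sym (bit (x ! i))"
    and "i < n \<Longrightarrow> tape (word x y) ! Suc (2 * n + i) = Sym (bit (y ! i))"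
    and "p \<le> 3 * n + 1 \<Longrightarrow> fits n p (tape (word x y) ! p)"
proof -
  have len: "length (word x y) = 3 * n" using assms by (simp add: word_def)
  show "i < n \<Longrightarrow> tape (word x y) ! Suc i = Sym (bit (x ! i))"
    and "i < n \<Longrightarrow> tape (word x y) ! Suc (2 * n + i) = Sym (bit (y ! i))"
    using assms len by (auto simp: word_def nth_append)
  show "fits n p (tape (word x y) ! p)" if "p \<le> 3 * n + 1"
  proof -
    have "p = 0 \<or> (\<exists>i<3 * n. p = Suc i) \<or> p = Suc (3 * n)"
      using that by (cases p) auto
    then consider "p = 0" | i where "p = Suc i" "i < 3 * n" | "p = Suc (length (word x y))"
      using len by auto
    then show ?thesis
    proof cases
      case 2
      then show ?thesis using assms len
        by (auto simp: fits_def word_def nth_append bit_def)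
    qed (use len tape_nth(3)[of "word x y"] in \<open>auto simp: fits_def\<close>)
  qed
qed

text \<open>The test puts the right end-marker exactly at \<open>3 * n + 1\<close>: a shorter word
  would show it earlier, a longer one would have a letter there. With the length fixed, both bit
  strings can be read off.\<close>

lemma fits_imp_word:
  assumes fits: "\<And>p. p \<le> 3 * n + 1 \<Longrightarrow> fits n p (tape w ! p)"
  shows "\<exists>x y. length x = n \<and> length y = n \<and> w = word x y"
proof -
  have len: "length w = 3 * n"
  proof (cases "length w < 3 * n + 1")
    case True
    then show ?thesis using fits[of "Suc (length w)"] by (simp add: fits_def)
  next
    case False
    then show ?thesis using fits[of "Suc (3 * n)"] by (auto simp: fits_def split: if_splits)
  qed
  have w: "fits n (Suc i) (Sym (w ! i))" if "i < 3 * n" for i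
    using fits[of "Suc i"] that len by simp
  have bit: "a \<noteq> Hash \<Longrightarrow> bit (a = One) = a" for a by (cases a) (auto simp: bit_def)
  define x where "x = map (\<lambda>i. w ! i = One) [0..<n]"
  define y where "y = map (\<lambda>i. w ! (2 * n + i) = One) [0..<n]"
  have "w = word x y"
  proof (rule nth_equalityI)
    show "length w = length (word x y)" by (simp add: len word_def x_def y_def)
    fix i assume "i < length w"
    then have i: "i < 3 * n" by (simp add: len)
    consider "i < n" | "n \<le> i" "i < 2 * n" | "2 * n \<le> i" by linarith
    then show "w ! i = word x y ! i"
      using w[OF i] i bit[of "w ! i"]
      by cases (auto simp: word_def x_def y_def nth_append fits_def split: if_splits)
  qed
  moreover have "length x = n" "length y = n" by (simp_all add: x_def y_def)
  ultimately show ?thesis by blast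
qed

text \<open>The cell of \<open>x ! i\<close> is recognised by the head position, hence twice per
  double sweep, so the second visit uncomputes the ancilla. The cell of \<open>y ! i\<close> is
  recognised by the time of its visit on the way right, hence once, so the change of the answer bit
  stays.\<close>

definition step_label :: "nat \<Rightarrow> (bool \<Rightarrow> bool \<Rightarrow> bool) \<Rightarrow> nat \<Rightarrow> sym cell \<Rightarrow>
    bool \<times> (nat \<times> bool \<times> nat) \<Rightarrow> bool \<times> (nat \<times> bool \<times> nat)" where
  "step_label n g \<tau> \<sigma> = (\<lambda>(a, i, b, w).
     if head_pos n \<tau> = i + 1 then (a \<noteq> (\<sigma> = Sym One), i, b, w)
     else if \<tau> = 2 * n + 1 + i then (a, i, b \<noteq> g a (\<sigma> = Sym One), w)
     else (a, i, b, w))"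

(* The invariant of a double sweep that starts with amplitudes G and ancilla 0. *)
definition sweep_amp :: "nat \<Rightarrow> (bool \<Rightarrow> bool \<Rightarrow> bool) \<Rightarrow> bool list \<Rightarrow> bool list \<Rightarrow>
    (nat \<times> bool \<times> nat \<Rightarrow> complex) \<Rightarrow> nat \<Rightarrow> bool \<times> (nat \<times> bool \<times> nat) \<Rightarrow> complex" where
  "sweep_amp n g x y G \<tau> = (\<lambda>(a, i, b, w).
     if a = (x ! i \<and> i + 1 < \<tau> \<and> \<tau> + i + 1 \<le> 6 * n + 2)
     then G (i, b \<noteq> (g (x ! i) (y ! i) \<and> 2 * n + 1 + i < \<tau>), w) else 0)"

text \<open>The time conditions in \<open>sweep_amp\<close> switch exactly at the steps where
  \<open>step_label\<close> toggles the ancilla or the answer bit. The relabelling stands in the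
  argument because amplitudes are pulled back along an involution.\<close>

lemma sweep_amp_step:
  assumes "length x = n" "length y = n" "i < n" "1 \<le> \<tau>" "\<tau> < 6 * n + 2"
  shows "sweep_amp n g x y G \<tau> (step_label n g \<tau> (tape (word x y) ! head_pos n \<tau>) (a, i, b, w))
    = sweep_amp n g x y G (Suc \<tau>) (a, i, b, w)"
proof -
  have "\<tau> = i + 1 \<or> \<tau> = 6 * n + 2 - (i + 1)" if "head_pos n \<tau> = i + 1"
    using that assms by (cases "\<tau> \<le> 3 * n + 1") (auto simp: head_pos_def)
  \<comment> \<open>In order: the head crosses \<open>x ! i\<close> on the way right,
    \<open>x ! i\<close> on the way left, \<open>y ! i\<close> on the way right, or labels with
    index \<open>i\<close> stay unchanged.\<close>
  then consider "\<tau> = i + 1" | "\<tau> = 6 * n + 2 - (i + 1)" | "\<tau> = 2 * n + 1 + i"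
    | "head_pos n \<tau> \<noteq> i + 1" "\<tau> \<noteq> 2 * n + 1 + i"
    by blast
  then show ?thesis
  proof cases
    case 1
    then have "head_pos n \<tau> = Suc i" using assms by (simp add: head_pos_def)
    then show ?thesis using 1 assms tape_word(1)[OF assms(1,2,3)]
      by (auto simp: step_label_def sweep_amp_def bit_def)
  next
    case 2
    then have \<tau>: "\<tau> + i = 6 * n + 1" using assms(3) by linarith
    have "i + 1 < \<tau>" "\<tau> + i + 1 \<le> 6 * n + 2" "2 * n + 1 + i < \<tau>"
      "\<not> Suc \<tau> + i + 1 \<le> 6 * n + 2" "2 * n + 1 + i < Suc \<tau>"
      using \<tau> assms(3) by linarith+
    then have conds: "(i + 1 < \<tau> \<and> \<tau> + i + 1 \<le> 6 * n + 2) = True" "(2 * n + 1 + i < \<tau>) = True"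
      "(i + 1 < Suc \<tau> \<and> Suc \<tau> + i + 1 \<le> 6 * n + 2) = False" "(2 * n + 1 + i < Suc \<tau>) = True"
      by blast+
    have hp: "head_pos n \<tau> = i + 1" using \<tau> assms(3) by (auto simp: head_pos_def)
    have "step_label n g \<tau> (tape (word x y) ! head_pos n \<tau>) (a, i, b, w) = (a \<noteq> x ! i, i, b, w)"
      using tape_word(1)[OF assms(1,2,3)] by (simp add: hp step_label_def bit_def)
    then show ?thesis by (simp only: sweep_amp_def conds split) simp
  next
    case 3
    then have "head_pos n \<tau> = Suc (2 * n + i)" using assms by (simp add: head_pos_def)
    \<comment> \<open>At this time the amplitude can be nonzero only where the ancilla equals
      \<open>x ! i\<close>, so \<open>g\<close> is evaluated at the right argument.\<close>
    then show ?thesis using 3 assms tape_word(2)[OF assms(1,2,3)]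
      by (auto simp: step_label_def sweep_amp_def bit_def)
  next
    case 4
    then have "\<tau> \<noteq> i + 1" "\<tau> + (i + 1) \<noteq> 6 * n + 2"
      using assms by (auto simp: head_pos_def split: if_splits)
    then have "(i + 1 < Suc \<tau>) = (i + 1 < \<tau>)" "(2 * n + 1 + i < Suc \<tau>) = (2 * n + 1 + i < \<tau>)"
        "(Suc \<tau> + i + 1 \<le> 6 * n + 2) = (\<tau> + i + 1 \<le> 6 * n + 2)"
      using 4(2) by linarith+
    then show ?thesis by (simp only: step_label_def sweep_amp_def split 4 if_False)
  qed
qed

text \<open>Every branch toggles at most one bit, by a value independent of that bit, and no toggled
  bit influences the choice of the branch.\<close>

lemma step_label_involution:
  "step_label n g \<tau> \<sigma> (step_label n g \<tau> \<sigma> l) = l"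
  by (cases l) (auto simp: step_label_def)

section \<open>The simulating automaton\<close>

locale query_simulation =
  fixes n k t :: nat and g :: "bool \<Rightarrow> bool \<Rightarrow> bool" and A :: query_alg and W :: "complex mat"
  assumes alg: "query_algorithm n k t A"
    and W: "unitary k W" "W *\<^sub>v unit_vec k 0 = start A"
    and t: "t \<ge> 1"
begin

abbreviation "B \<equiv> basis_labels A"

(* The automaton prepares the start vector by W, since its register starts in a basis state. *)
definition op_at :: "nat \<Rightarrow> sym cell \<Rightarrow> complex mat" where
  "op_at s \<sigma> = (let \<tau> = s mod period n; j = s div period n in
     if \<tau> = 0 then with_ancilla (if j = 0 then unitaries A ! 0 * W else unitaries A ! j)
     else relabel_mat (2 * k) (joint_label B) (step_label n g \<tau> \<sigma>))"

text \<open>The counter passes through \<open>t\<close> double sweeps and one more step for the last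
  unitary before the measurement. The two numbers after it are the accepting and the rejecting
  state.\<close>

abbreviation "meas_state \<equiv> period n * t + 1"

definition sim :: "(nat, sym) qcfa" where
  "sim = \<lparr> qdim = 2 * k, qinit = 0, cstates = {..<meas_state + 3}, cinit = 0,
     acc = {meas_state + 1}, rej = {meas_state + 2},
     theta = (\<lambda>s \<sigma>. if s = meas_state then Measure (map with_ancilla (final_meas A))
       else Unitary (op_at s \<sigma>)),
     delta_u = (\<lambda>s \<sigma>. if fits n (head_pos n (s mod period n)) \<sigma>
       then (s + 1, if s mod period n \<le> 3 * n then MoveRight else MoveLeft)
       else (meas_state + 2, Stay)),
     delta_m = (\<lambda>s \<sigma> c. (if out A c then meas_state + 1 else meas_state + 2, Stay)) \<rparr>"

section \<open>Facts on the query algorithm and well-formedness of the automaton\<close>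

lemma labels: "distinct B" "length B = k"
  and label_bound: "(i, b, w) \<in> set B \<Longrightarrow> i < n"
  and label_flip: "(i, b, w) \<in> set B \<Longrightarrow> (i, \<not> b, w) \<in> set B"
  and start_state: "start A \<in> carrier_vec k" "vnorm (start A) = 1"
  and unitary_nth: "j \<le> t \<Longrightarrow> unitary k (unitaries A ! j)"
  and final_measurement: "orth_measurement k (final_meas A)"
  using alg by (auto simp: query_algorithm_def)

text \<open>The start vector has norm 1, so some label exists; flipping its answer bit gives a
  second one, and its index is below \<open>n\<close>.\<close>

lemma k_ge_2: "k \<ge> 2" and n_ge_1: "n \<ge> 1"
proof -
  have "k \<noteq> 0"
  proof
    assume "k = 0"
    then show False using start_state by (simp add: vnorm_def)
  qed
  then obtain i b w where "(i, b, w) \<in> set B" using labels(2) by (cases B) auto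
  then have "{(i, b, w), (i, \<not> b, w)} \<subseteq> set B" "i < n"
    using label_flip label_bound by auto
  then show "k \<ge> 2" "n \<ge> 1"
    using card_mono[of "set B" "{(i, b, w), (i, \<not> b, w)}"] distinct_card[of B] labels by auto
qed

lemma label_flip_neq: "(i, b, w) \<in> set B \<Longrightarrow> (i, b \<noteq> c, w) \<in> set B"
  using label_flip by (cases c) auto

lemma step_label_closed:
  "l \<in> UNIV \<times> set B \<Longrightarrow> step_label n g \<tau> \<sigma> l \<in> UNIV \<times> set B"
  using label_flip_neq by (auto simp: step_label_def)

lemma bij_joint_label: "bij_betw (joint_label B) {..<2 * k} (UNIV \<times> set B)"
  using bij_betw_joint_label[OF labels(1)] labels(2) by simp

lemma unitary_op_at:
  assumes "s \<le> period n * t"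
  shows "unitary (2 * k) (op_at s \<sigma>)"
proof -
  have "s div period n \<le> period n * t div period n" using assms by (rule div_le_mono)
  moreover have "period n > 0" by (simp add: period_def)
  ultimately have "unitary k (unitaries A ! (s div period n))" "unitary k (unitaries A ! 0)"
    using unitary_nth by simp_all
  moreover have "unitary (2 * k) (relabel_mat (2 * k) (joint_label B) (step_label n g \<tau> \<sigma>))" for \<tau>
    using step_label_closed step_label_involution
    by (intro unitary_relabel_mat[OF bij_joint_label]) auto
  ultimately show ?thesis
    using W(1) by (simp add: op_at_def Let_def unitary_with_ancilla unitary_mult)
qed

lemma sim_simps:
  "qdim sim = 2 * k" "qinit sim = 0" "cstates sim = {..<meas_state + 3}" "cinit sim = 0"
  "acc sim = {meas_state + 1}" "rej sim = {meas_state + 2}"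
  "theta sim s \<sigma> = (if s = meas_state then Measure (map with_ancilla (final_meas A))
     else Unitary (op_at s \<sigma>))"
  "delta_u sim s \<sigma> = (if fits n (head_pos n (s mod period n)) \<sigma>
     then (s + 1, if s mod period n \<le> 3 * n then MoveRight else MoveLeft)
     else (meas_state + 2, Stay))"
  "delta_m sim s \<sigma> c = (if out A c then meas_state + 1 else meas_state + 2, Stay)"
  by (simp_all add: sim_def)

lemma is_2qcfa_sim: "is_2qcfa sim"
  unfolding is_2qcfa_def
proof (intro conjI ballI allI)
  fix s \<sigma> assume s: "s \<in> cstates sim - (acc sim \<union> rej sim)"
  show "case theta sim s \<sigma> of
          Unitary U \<Rightarrow> unitary (qdim sim) U \<and> legal_move sim \<sigma> (delta_u sim s \<sigma>)
        | Measure Ps \<Rightarrow> orth_measurement (qdim sim) Ps \<and>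
            (\<forall>c<length Ps. legal_move sim \<sigma> (delta_m sim s \<sigma> c))"
  proof (cases "s = meas_state")
    case True
    then show ?thesis using orth_measurement_with_ancilla[OF final_measurement]
      by (simp add: sim_simps legal_move_def)
  next
    case False
    then have s: "s \<le> period n * t" using s by (auto simp: sim_simps)
    \<comment> \<open>Below the period, position 0 is expected only at time 0, where the move is to
      the right, and position \<open>3 * n + 1\<close> only where the move is to the left.\<close>
    have "s mod period n < 6 * n + 2" by (simp add: period_def)
    then have "legal_move sim \<sigma> (delta_u sim s \<sigma>)"
      using s by (auto simp: sim_simps legal_move_def fits_def head_pos_def split: if_splits)
    then show ?thesis using False unitary_op_at[OF s] by (simp add: sim_simps(1,7))
  qed
qed (use k_ge_2 in \<open>auto simp: sim_simps\<close>)

section \<open>Runs of the automaton\<close>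

fun sim_state :: "sym list \<Rightarrow> nat \<Rightarrow> complex vec" where
  "sim_state w 0 = unit_vec (2 * k) 0"
| "sim_state w (Suc s) = op_at s (tape w ! head_pos n (s mod period n)) *\<^sub>v sim_state w s"

text \<open>The two moves chosen by \<open>delta_u\<close> keep the head where the counter predicts
  it, also when the counter wraps around.\<close>

lemma head_pos_step:
  "s mod period n \<le> 3 * n \<Longrightarrow> head_pos n (Suc s mod period n) = head_pos n (s mod period n) + 1"
  "\<not> s mod period n \<le> 3 * n \<Longrightarrow> head_pos n (Suc s mod period n) = head_pos n (s mod period n) - 1"
proof -
  have "s mod period n < 6 * n + 2" by (simp add: period_def)
  then show "s mod period n \<le> 3 * n \<Longrightarrow>
      head_pos n (Suc s mod period n) = head_pos n (s mod period n) + 1"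
    "\<not> s mod period n \<le> 3 * n \<Longrightarrow>
      head_pos n (Suc s mod period n) = head_pos n (s mod period n) - 1"
    by (auto simp: mod_Suc head_pos_def period_def)
qed

lemma accept_within_rej: "accept_within sim w T (meas_state + 2, c) = 0"
proof (cases T)
  case (Suc T')
  have "successors sim w (meas_state + 2, c) = []"
    by (cases c) (simp add: successors_def sim_simps(5,6))
  then show ?thesis using Suc by (simp add: sim_simps(5))
qed (simp add: sim_simps(5))

lemma accept_within_acc: "accept_within sim w T (meas_state + 1, c) = 1"
  by (cases T) (simp_all add: sim_simps(5))

lemma accept_within_step:
  assumes "s \<le> period n * t"
  shows "accept_within sim w (Suc T) (s, head_pos n (s mod period n), \<psi>)
    = (if fits n (head_pos n (s mod period n)) (tape w ! head_pos n (s mod period n))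
       then accept_within sim w T (Suc s, head_pos n (Suc s mod period n),
         op_at s (tape w ! head_pos n (s mod period n)) *\<^sub>v \<psi>) else 0)"
proof -
  define p where "p = head_pos n (s mod period n)"
  define U where "U = op_at s (tape w ! p)"
  have s: "s \<noteq> meas_state" "s \<notin> acc sim \<union> rej sim" using assms by (auto simp: sim_simps(5,6))
  have th: "theta sim s (tape w ! p) = Unitary U"
    using s(1) by (simp add: sim_simps(7) U_def)
  obtain s' m where sm: "delta_u sim s (tape w ! p) = (s', m)" by fastforce
  have succ: "successors sim w (s, p, \<psi>) = [(1, s', move_head p m, U *\<^sub>v \<psi>)]"
    using s(2) th sm by (simp add: successors_def)
  have "accept_within sim w (Suc T) (s, p, \<psi>) = accept_within sim w T (s', move_head p m, U *\<^sub>v \<psi>)"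
    using s(2) by (simp add: succ)
  also have "\<dots> = (if fits n p (tape w ! p)
       then accept_within sim w T (Suc s, head_pos n (Suc s mod period n), U *\<^sub>v \<psi>) else 0)"
  proof (cases "fits n p (tape w ! p)")
    case True
    then have "s' = Suc s" "move_head p m = head_pos n (Suc s mod period n)"
      using sm head_pos_step[of s] by (auto simp: sim_simps(8) p_def[symmetric] split: if_splits)
    then show ?thesis using True by simp
  next
    case False
    then have "s' = meas_state + 2" using sm by (simp add: sim_simps(8) p_def[symmetric])
    then show ?thesis using False by (simp only: accept_within_rej if_False)
  qed
  finally show ?thesis by (simp only: p_def U_def)
qed

text \<open>Each outcome enters a halting state, where acceptance is 1 or 0 whatever vector is
  attached; what remains is the weight of the outcomes with output true.\<close>

lemma accept_within_meas:
  "accept_within sim w (Suc T) (meas_state, p, \<psi>)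
    = (\<Sum>c | c < length (final_meas A) \<and> out A c.
        (vnorm (with_ancilla (final_meas A ! c) *\<^sub>v \<psi>))\<^sup>2)"
proof -
  have "accept_within sim w (Suc T) (meas_state, p, \<psi>)
      = (\<Sum>c\<leftarrow>[0..<length (final_meas A)]. (vnorm (with_ancilla (final_meas A ! c) *\<^sub>v \<psi>))\<^sup>2 *
          (if out A c then 1 else 0))"
  proof -
    have "successors sim w (meas_state, p, \<psi>) =
       map (\<lambda>c. ((vnorm (with_ancilla (final_meas A ! c) *\<^sub>v \<psi>))\<^sup>2,
          (if out A c then meas_state + 1 else meas_state + 2), p,
          complex_of_real (1 / vnorm (with_ancilla (final_meas A ! c) *\<^sub>v \<psi>)) \<cdot>\<^sub>v
            (with_ancilla (final_meas A ! c) *\<^sub>v \<psi>))) [0..<length (final_meas A)]"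
      by (simp add: successors_def sim_simps(5-9) Let_def)
    moreover have "meas_state \<notin> acc sim" by (simp add: sim_simps)
    ultimately show ?thesis
      by (simp add: o_def if_distrib[of "\<lambda>s. accept_within sim w T (s, _)"]
          accept_within_rej[simplified] accept_within_acc[simplified] cong: if_cong)
  qed
  also have "\<dots> = (\<Sum>c<length (final_meas A).
      if out A c then (vnorm (with_ancilla (final_meas A ! c) *\<^sub>v \<psi>))\<^sup>2 else 0)"
    by (auto simp: interv_sum_list_conv_sum_set_nat lessThan_atLeast0 intro!: sum.cong)
  also have "\<dots> = (\<Sum>c | c < length (final_meas A) \<and> out A c.
        (vnorm (with_ancilla (final_meas A ! c) *\<^sub>v \<psi>))\<^sup>2)"
    by (simp flip: sum.inter_filter)
  finally show ?thesis .
qed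


text \<open>Unrolls the first \<open>s\<close> steps, in which the computation does not branch. It
  is applied up to the measurement on well-formed tapes and up to the first misplaced cell on all
  others.\<close>

lemma accept_within_sim_state:
  assumes "s \<le> meas_state"
    and "\<And>s'. s' < s \<Longrightarrow>
      fits n (head_pos n (s' mod period n)) (tape w ! head_pos n (s' mod period n))"
  shows "accept_within sim w (s + T) (init_config sim)
    = accept_within sim w T (s, head_pos n (s mod period n), sim_state w s)"
  using assms
proof (induction s arbitrary: T)
  case 0
  then show ?case by (simp add: init_config_def sim_simps head_pos_def)
next
  case (Suc s)
  have "accept_within sim w (s + Suc T) (init_config sim)
      = accept_within sim w (Suc T) (s, head_pos n (s mod period n), sim_state w s)"
    by (intro Suc.IH) (use Suc.prems in auto)
  also have "\<dots> = accept_within sim w T (Suc s, head_pos n (Suc s mod period n), sim_state w (Suc s))"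
    using Suc.prems by (subst accept_within_step) auto
  finally show ?case by simp
qed

section \<open>Queries and output probabilities of the query algorithm\<close>

lemma unitary_query_mat: "unitary k (query_mat A z)"
  and query_mat_mult_vec:
    "query_mat A z *\<^sub>v vec k (\<lambda>r. F (B ! r)) = vec k (\<lambda>r. F (query_label z (B ! r)))"
proof -
  have bij: "bij_betw ((!) B) {..<k} (set B)"
    using bij_betw_nth[OF labels(1)] labels(2) by auto
  have "query_label z l \<in> set B \<and> query_label z (query_label z l) = l" if "l \<in> set B" for l
  proof -
    obtain i b w where "l = (i, b, w)" by (metis surj_pair)
    then show ?thesis using that label_flip_neq by (auto simp: query_label_def)
  qed
  note * = bij this
  show "unitary k (query_mat A z)"
    unfolding query_mat_eq_relabel_mat labels(2) by (rule unitary_relabel_mat[OF *])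
  show "query_mat A z *\<^sub>v vec k (\<lambda>r. F (B ! r)) = vec k (\<lambda>r. F (query_label z (B ! r)))"
    unfolding query_mat_eq_relabel_mat labels(2) by (rule relabel_mat_mult_vec[OF *])
qed

lemma query_state_carrier: "j \<le> t \<Longrightarrow> query_state A z j \<in> carrier_vec k"
  and vnorm_query_state: "j \<le> t \<Longrightarrow> vnorm (query_state A z j) = 1"
proof (induction j)
  case 0
  { case 1
    then show ?case using unitary_nth[of 0] start_state by (auto simp: unitary_def)
  next
    case 2
    then show ?case using unitary_nth[of 0] start_state by (simp add: vnorm_unitary) }
next
  case (Suc j)
  have Q: "query_mat A z *\<^sub>v query_state A z j \<in> carrier_vec k" if "Suc j \<le> t"
    using Suc(1) that unitary_query_mat[of z] by (auto simp: unitary_def)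
  { case 1
    then show ?case using unitary_nth[of "Suc j"] Q by (auto simp: unitary_def)
  next
    case 2
    then show ?case using unitary_nth[of "Suc j"] Q unitary_query_mat[of z] Suc
      by (simp add: vnorm_unitary) }
qed

text \<open>The final state is a unit vector, so the outcome probabilities add up to 1. This turns
  the lower bound on the correct output into an upper bound on the wrong one.\<close>

lemma output_prob_complement:
  "output_prob A t z b + output_prob A t z (\<not> b) = 1"
proof -
  let ?f = "\<lambda>c. (vnorm (final_meas A ! c *\<^sub>v query_state A z t))\<^sup>2"
  let ?S = "\<lambda>b. {c. c < length (final_meas A) \<and> out A c = b}"
  have "output_prob A t z b + output_prob A t z (\<not> b) = sum ?f (?S b \<union> ?S (\<not> b))"
    unfolding output_prob_def by (rule sum.union_disjoint[symmetric]) auto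
  also have "?S b \<union> ?S (\<not> b) = {..<length (final_meas A)}" by auto
  also have "sum ?f \<dots> = 1"
    using orth_measurement_total[OF final_measurement query_state_carrier] vnorm_query_state
    by simp
  finally show ?thesis .
qed

section \<open>A double sweep acts as a query\<close>

lemma sim_state_sweep:
  assumes xy: "length x = n" "length y = n"
    and init: "sim_state (word x y) (period n * j + 1) = vec k (\<lambda>r. G (B ! r)) @\<^sub>v 0\<^sub>v k"
    and \<tau>: "1 \<le> \<tau>" "\<tau> \<le> period n"
  shows "sim_state (word x y) (period n * j + \<tau>)
    = vec (2 * k) (\<lambda>r. sweep_amp n g x y G \<tau> (joint_label B r))"
  using \<tau>
proof (induction \<tau> rule: nat_induct_at_least)
  case base
  \<comment> \<open>At time 1 neither time condition of the invariant holds yet. Time 0 is left out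
    because that step applies a unitary of the query algorithm instead of a relabelling.\<close>
  have "sweep_amp n g x y G 1 (a, l) = (if a then 0 else G l)" for a l
    by (cases l) (simp add: sweep_amp_def)
  then show ?case using joint_label_vec[of B G] init labels(2)
    by (simp add: joint_label_def)
next
  case (Suc \<tau>)
  let ?s = "period n * j + \<tau>" and ?\<sigma> = "tape (word x y) ! head_pos n \<tau>"
  have \<tau>: "1 \<le> \<tau>" "\<tau> < period n" using Suc by auto
  then have s: "?s mod period n = \<tau>" by simp
  have amp: "sweep_amp n g x y G \<tau> (step_label n g \<tau> ?\<sigma> l) = sweep_amp n g x y G (Suc \<tau>) l"
    if "l \<in> UNIV \<times> set B" for l
    using that sweep_amp_step[OF xy] \<tau> label_bound by (auto simp: period_def)
  have "sim_state (word x y) (period n * j + Suc \<tau>) = op_at ?s ?\<sigma> *\<^sub>v sim_state (word x y) ?s"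
    using \<tau> by simp
  also have "op_at ?s ?\<sigma> = relabel_mat (2 * k) (joint_label B) (step_label n g \<tau> ?\<sigma>)"
    using \<tau> by (simp add: op_at_def s)
  also have "sim_state (word x y) ?s = vec (2 * k) (\<lambda>r. sweep_amp n g x y G \<tau> (joint_label B r))"
    using Suc by simp
  also have "relabel_mat (2 * k) (joint_label B) (step_label n g \<tau> ?\<sigma>) *\<^sub>v \<dots>
      = vec (2 * k) (\<lambda>r. sweep_amp n g x y G \<tau> (step_label n g \<tau> ?\<sigma> (joint_label B r)))"
    using step_label_closed step_label_involution
    by (intro relabel_mat_mult_vec[OF bij_joint_label]) auto
  also have "\<dots> = vec (2 * k) (\<lambda>r. sweep_amp n g x y G (Suc \<tau>) (joint_label B r))"
  proof (intro eq_vecI)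
    fix r assume "r < dim_vec (vec (2 * k) (\<lambda>r. sweep_amp n g x y G (Suc \<tau>) (joint_label B r)))"
    then have r: "r < 2 * k" by simp
    then have "joint_label B r \<in> UNIV \<times> set B" using bij_betwE[OF bij_joint_label] by blast
    then show "vec (2 * k) (\<lambda>r. sweep_amp n g x y G \<tau> (step_label n g \<tau> ?\<sigma> (joint_label B r))) $ r
        = vec (2 * k) (\<lambda>r. sweep_amp n g x y G (Suc \<tau>) (joint_label B r)) $ r"
      using r by (simp add: amp)
  qed simp
  finally show ?case .
qed

lemma sim_state_query_state:
  assumes xy: "length x = n" "length y = n"
  shows "j \<le> t \<Longrightarrow>
    sim_state (word x y) (period n * j + 1) = query_state A (map2 g x y) j @\<^sub>v 0\<^sub>v k"
proof (induction j)
  case 0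
  have c: "unitaries A ! 0 \<in> carrier_mat k k" "W \<in> carrier_mat k k"
    using unitary_nth[of 0] W by (auto simp: unitary_def)
  have "unit_vec (2 * k) 0 = (unit_vec k 0 @\<^sub>v 0\<^sub>v k :: complex vec)"
    using k_ge_2 by (intro eq_vecI) auto
  then have "sim_state (word x y) 1 = ((unitaries A ! 0 * W) *\<^sub>v unit_vec k 0) @\<^sub>v 0\<^sub>v k"
    using with_ancilla_mult_vec[of "unitaries A ! 0 * W" k "unit_vec k 0"] c
    by (simp add: op_at_def)
  then show ?case using c W(2) by (simp add: assoc_mult_mat_vec[of _ k k _ k])
next
  case (Suc j)
  let ?z = "map2 g x y" and ?w = "word x y"
  \<comment> \<open>Rewrites the coordinates of the query state as amplitudes indexed by labels, as
    the sweep invariant requires.\<close>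
  define G where "G l = query_state A ?z j $ inv_into {..<k} ((!) B) l" for l
  have "inj_on ((!) B) {..<k}" using labels by (auto simp: inj_on_def nth_eq_iff_index_eq)
  then have G: "query_state A ?z j = vec k (\<lambda>r. G (B ! r))"
    using query_state_carrier[of j ?z] Suc.prems by (intro eq_vecI) (auto simp: G_def)
  let ?Q = "query_mat A ?z *\<^sub>v query_state A ?z j"
  have U: "unitaries A ! Suc j \<in> carrier_mat k k"
    using unitary_nth[OF Suc.prems] by (simp add: unitary_def)
  have Q: "?Q \<in> carrier_vec k"
    using query_state_carrier[of j ?z] Suc.prems unitary_query_mat[of ?z] by (auto simp: unitary_def)
  have "sim_state ?w (period n * j + period n)
      = vec (2 * k) (\<lambda>r. sweep_amp n g x y G (period n) (joint_label B r))"
    using Suc G by (intro sim_state_sweep[OF xy]) (auto simp: period_def)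
  \<comment> \<open>At the end of the double sweep the ancilla is back to 0, and
    \<open>g (x ! i) (y ! i)\<close> has been added to the answer bit: the effect of a query to
    \<open>?z\<close>.\<close>
  also have "\<dots> = vec (2 * k) (\<lambda>r. case joint_label B r of (a, l) \<Rightarrow>
      if a then 0 else G (query_label ?z l))"
  proof (intro eq_vecI)
    fix r assume "r < dim_vec (vec (2 * k) (\<lambda>r. case joint_label B r of (a, l) \<Rightarrow>
      if a then 0 else G (query_label ?z l)))"
    then have r: "r < 2 * k" by simp
    obtain a i b v where l: "joint_label B r = (a, i, b, v)" by (metis surj_pair)
    moreover have "joint_label B r \<in> UNIV \<times> set B"
      using bij_betwE[OF bij_joint_label] r by blast
    ultimately have "(i, b, v) \<in> set B" by simp
    then have "i < n" by (rule label_bound)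
    then show "vec (2 * k) (\<lambda>r. sweep_amp n g x y G (period n) (joint_label B r)) $ r
        = vec (2 * k) (\<lambda>r. case joint_label B r of (a, l) \<Rightarrow>
            if a then 0 else G (query_label ?z l)) $ r"
      using r l xy by (simp add: sweep_amp_def query_label_def period_def)
  qed simp
  also have "\<dots> = ?Q @\<^sub>v 0\<^sub>v k"
    using joint_label_vec[of B "\<lambda>l. G (query_label ?z l)"] query_mat_mult_vec[of ?z G] G labels(2)
    by simp
  finally have "sim_state ?w (period n * Suc j) = ?Q @\<^sub>v 0\<^sub>v k" by (simp add: add.commute)
  moreover have "period n * Suc j mod period n = 0" by (rule mod_mult_self1_is_0)
  moreover have "period n * Suc j div period n = Suc j"
    by (rule nonzero_mult_div_cancel_left) (simp add: period_def)
  ultimately have "sim_state ?w (Suc (period n * Suc j))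
      = with_ancilla (unitaries A ! Suc j) *\<^sub>v (?Q @\<^sub>v 0\<^sub>v k)"
    by (simp only: sim_state.simps op_at_def Let_def) simp
  then show ?case using with_ancilla_mult_vec[OF U Q] by simp
qed

section \<open>Acceptance probabilities\<close>

lemma accept_prob_word:
  assumes xy: "length x = n" "length y = n"
  shows "accept_prob sim (word x y) = output_prob A t (map2 g x y) True"
proof -
  let ?w = "word x y" and ?z = "map2 g x y" and ?p = "output_prob A t (map2 g x y) True"
  let ?c = "init_config sim"
  have fits: "fits n (head_pos n (s mod period n)) (tape ?w ! head_pos n (s mod period n))" for s
  proof (rule tape_word(3)[OF xy])
    have "s mod period n < period n" by (simp add: period_def)
    then show "head_pos n (s mod period n) \<le> 3 * n + 1"
      by (auto simp: head_pos_def period_def)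
  qed
  have P: "final_meas A ! c \<in> carrier_mat k k" if "c < length (final_meas A)" for c
    using final_measurement that by (auto simp: orth_measurement_def)
  \<comment> \<open>The bounded acceptance probability is 0 until the measurement and constant
    afterwards, so the supremum is the constant value.\<close>
  have late: "accept_within sim ?w (meas_state + Suc T) ?c = ?p" for T
  proof -
    have "accept_within sim ?w (meas_state + Suc T) ?c = (\<Sum>c | c < length (final_meas A) \<and> out A c.
        (vnorm (with_ancilla (final_meas A ! c) *\<^sub>v sim_state ?w meas_state))\<^sup>2)"
      by (simp only: accept_within_sim_state[OF order_refl fits] accept_within_meas)
    also have "\<dots> = ?p"
      unfolding output_prob_def
    proof (intro sum.cong)
      fix c assume "c \<in> {c. c < length (final_meas A) \<and> out A c = True}"
      then show "(vnorm (with_ancilla (final_meas A ! c) *\<^sub>v sim_state ?w meas_state))\<^sup>2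
          = (vnorm (final_meas A ! c *\<^sub>v query_state A ?z t))\<^sup>2"
        using sim_state_query_state[OF xy, of t] P[of c]
          with_ancilla_mult_vec[of _ k, OF _ query_state_carrier[of t ?z]]
        by (simp add: vnorm_append_zero)
    qed simp
    finally show ?thesis .
  qed
  have early: "accept_within sim ?w T ?c = 0" if "T \<le> meas_state" for T
    using accept_within_sim_state[of T ?w 0] that fits by (simp add: sim_simps)
  have p: "0 \<le> ?p" by (simp add: output_prob_def sum_nonneg)
  have le: "accept_within sim ?w T ?c \<le> ?p" for T
  proof (cases "T \<le> meas_state")
    case False
    then have "T = meas_state + Suc (T - meas_state - 1)" by simp
    then show ?thesis using late by (metis order_refl)
  qed (use early p in simp)
  show ?thesis unfolding accept_prob_def
  proof (rule antisym)
    show "(SUP T. accept_within sim ?w T ?c) \<le> ?p" by (rule cSUP_least) (use le in auto)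
    have "accept_within sim ?w (meas_state + Suc 0) ?c \<le> (SUP T. accept_within sim ?w T ?c)"
      by (rule cSUP_upper) (use le in \<open>auto intro!: bdd_aboveI[of _ ?p]\<close>)
    then show "?p \<le> (SUP T. accept_within sim ?w T ?c)" by (simp only: late)
  qed
qed

text \<open>All cells before the first misplaced one pass the test, so the first sweep to the right
  reaches that cell and rejects there.\<close>

lemma accept_prob_malformed:
  assumes "\<And>x y. length x = n \<Longrightarrow> length y = n \<Longrightarrow> w \<noteq> word x y"
  shows "accept_prob sim w = 0"
proof -
  define bad where "bad p \<longleftrightarrow> \<not> fits n p (tape w ! p)" for p
  obtain q where "q \<le> 3 * n + 1" "bad q"
    using fits_imp_word[of n w] assms by (auto simp: bad_def)
  then have p: "\<exists>p. p \<le> 3 * n + 1 \<and> bad p" by blast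
  define p where "p = (LEAST p. p \<le> 3 * n + 1 \<and> bad p)"
  have p: "p \<le> 3 * n + 1" "bad p" "\<And>p'. p' < p \<Longrightarrow> \<not> bad p'"
    using LeastI_ex[OF p, folded p_def]
      not_less_Least[of _ "\<lambda>p. p \<le> 3 * n + 1 \<and> bad p", folded p_def]
    by (blast, blast, meson less_imp_le order_trans)
  have head: "head_pos n (s mod period n) = s" if "s \<le> p" for s
    using that p(1) by (simp add: period_def head_pos_def)
  \<comment> \<open>Since \<open>t \<ge> 1\<close>, a whole double sweep takes place before the
    measurement.\<close>
  have "period n * 1 \<le> period n * t" using t by (intro mult_left_mono) auto
  then have pt: "p \<le> period n * t" using p(1) by (simp add: period_def)
  have run: "accept_within sim w (s + T) (init_config sim)
      = accept_within sim w T (s, head_pos n (s mod period n), sim_state w s)" if "s \<le> p" for s T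
    by (rule accept_within_sim_state) (use that pt p(3) head in \<open>auto simp: bad_def\<close>)
  have "accept_within sim w T (init_config sim) = 0" for T
  proof (cases "T \<le> p")
    case True
    then show ?thesis using run[of T 0] pt by (simp add: sim_simps)
  next
    case False
    then have T: "T = p + Suc (T - p - 1)" by simp
    have "accept_within sim w (p + Suc (T - p - 1)) (init_config sim) = 0"
      using p(2) head[OF order_refl] accept_within_step[OF pt, of w "T - p - 1" "sim_state w p"]
      by (simp only: run[OF order_refl] bad_def if_False)
    then show ?thesis using T by metis
  qed
  then show ?thesis by (simp add: accept_prob_def)
qed

section \<open>Running time, recognition error and the TS bound\<close>

lemma run_time_sim: "run_time sim \<le> enat (period n * t + 3)"
proof -
  \<comment> \<open>The numbering makes every step raise the classical state, the halting states
    being the largest; hence the state reached bounds the number of steps.\<close>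
  have "j \<le> fst c \<and> fst c \<le> meas_state + 2" if "(init_config sim, c) \<in> step sim w ^^ j" for w c j
    using that
  proof (induction j arbitrary: c)
    case 0
    then show ?case by (auto simp: init_config_def sim_simps)
  next
    case (Suc j)
    then obtain s p \<psi> where c': "(init_config sim, (s, p, \<psi>)) \<in> step sim w ^^ j"
        "((s, p, \<psi>), c) \<in> step sim w" by (auto elim: relpow_Suc_E)
    then have s: "j \<le> s" using Suc.IH by fastforce
    obtain r where r: "(r, c) \<in> set (successors sim w (s, p, \<psi>))"
      using c'(2) by (auto simp: step_def)
    then have "s \<notin> acc sim \<union> rej sim" by (auto simp: successors_def)
    moreover have "s \<le> meas_state + 2" using Suc.IH[OF c'(1)] by simp
    ultimately have "s \<le> meas_state" by (auto simp: sim_simps)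
    moreover have "fst c = Suc s \<or> fst c = meas_state + 1 \<or> fst c = meas_state + 2"
    proof (cases "s = meas_state")
      case True
      then show ?thesis using r
        by (auto simp: successors_def sim_simps(5-9) Let_def split: if_splits)
    next
      case False
      then show ?thesis using r
        by (auto simp: successors_def sim_simps(5-9) Let_def split: if_splits)
    qed
    ultimately show ?case using s by auto
  qed
  then show ?thesis unfolding run_time_def by (fastforce intro!: Sup_least)
qed


lemma recognizes_sim:
  assumes "computes A n t h \<epsilon>"
  shows "recognizes sim (L_lang (compose_bitwise h g) n) \<epsilon>"
proof -
  have c: "output_prob A t z (h z) \<ge> 1 - \<epsilon>" if "length z = n" for z
    using assms that by (simp add: computes_def)
  have "0 \<le> output_prob A t z b" for z b by (simp add: output_prob_def sum_nonneg)
  \<comment> \<open>Malformed inputs call for a nonnegative error. It follows from one input of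
    length \<open>n\<close>, on which the success probability is at most 1.\<close>
  then have \<epsilon>: "0 \<le> \<epsilon>"
    using c[of "replicate n False"]
      output_prob_complement[of "replicate n False" "h (replicate n False)"]
    by (smt (verit) length_replicate)
  have member: "word x y \<in> L_lang (compose_bitwise h g) n"
    if "length x = n" "length y = n" "h (map2 g x y)" for x y
    using that by (auto simp: L_lang_def word_def compose_bitwise_def)
  show ?thesis unfolding recognizes_def
  proof (intro conjI ballI allI impI)
    fix w assume "w \<in> L_lang (compose_bitwise h g) n"
    then obtain x y where xy: "length x = n" "length y = n" and w: "w = word x y"
      and h: "h (map2 g x y)"
      by (auto simp: L_lang_def word_def compose_bitwise_def)
    show "accept_prob sim w \<ge> 1 - \<epsilon>"
      using c[of "map2 g x y"] xy h by (simp add: w accept_prob_word)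
  next
    fix w assume w: "w \<notin> L_lang (compose_bitwise h g) n"
    show "accept_prob sim w \<le> \<epsilon>"
    proof (cases "\<exists>x y. length x = n \<and> length y = n \<and> w = word x y")
      case True
      then obtain x y where xy: "length x = n" "length y = n" and "w = word x y" by blast
      moreover then have "\<not> h (map2 g x y)" using w member by blast
      ultimately show ?thesis
        using c[of "map2 g x y"] output_prob_complement[of "map2 g x y" True]
        by (simp add: accept_prob_word)
    next
      case False
      then have "accept_prob sim w = 0" by (intro accept_prob_malformed) blast
      then show ?thesis using \<epsilon> by simp
    qed
  qed
qed

lemma card_cstates_sim: "real (card (cstates sim)) \<le> 12 * (real t * real n)"
  and run_time_sim_le: "ereal_of_enat (run_time sim) \<le> ereal (12 * (real t * real n))"
proof -
  \<comment> \<open>These bounds absorb the lower-order terms: 6 + 2 + 4 = 12.\<close>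
  have "t \<le> t * n" "1 \<le> t * n" using t n_ge_1 by auto
  moreover have "period n * t + 4 = 6 * (t * n) + 2 * t + 4"
    by (simp add: period_def algebra_simps)
  ultimately have *: "period n * t + 4 \<le> 12 * (t * n)" by linarith
  then have "real (period n * t + 4) \<le> real (12 * (t * n))" by (rule of_nat_mono)
  then show "real (card (cstates sim)) \<le> 12 * (real t * real n)" by (simp add: sim_simps)
  have "run_time sim \<le> enat (12 * (t * n))"
    using run_time_sim by (rule order_trans) (use * in simp)
  then have "ereal_of_enat (run_time sim) \<le> ereal_of_enat (enat (12 * (t * n)))"
    by (simp only: ereal_of_enat_le_iff)
  then show "ereal_of_enat (run_time sim) \<le> ereal (12 * (real t * real n))" by simp
qed

lemma TS_sim:
  "TS sim \<le> ereal (36 * (real t * real n * (log 2 (real t * real n) + log 2 (2 * real k))))"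
proof -
  let ?T = "real t * real n"
  have "1 \<le> t * n" using t n_ge_1 by auto
  then have T: "1 \<le> ?T" by (metis of_nat_1 of_nat_le_iff of_nat_mult)
  have log_4: "log 2 4 = (2 :: real)" and log_16: "log 2 16 = (4 :: real)"
    using log_nat_power[of 2 2 2] log_nat_power[of 2 2 4] by simp_all
  have "log 2 4 \<le> log 2 (2 * real k)" using k_ge_2 by (subst log_le_cancel_iff) auto
  then have k2: "2 \<le> log 2 (2 * real k)" by (simp only: log_4)
  have "1 \<le> card (cstates sim)" by (simp add: sim_simps)
  then have card: "1 \<le> real (card (cstates sim))" by simp
  \<comment> \<open>The constant 12 is enlarged to 16 for the sake of an integral logarithm.\<close>
  have "log 2 (real (card (cstates sim))) \<le> log 2 (16 * ?T)"
    using card_cstates_sim card T by (subst log_le_cancel_iff) auto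
  also have "\<dots> = 4 + log 2 ?T" using T by (subst log_mult) (auto simp: log_16)
  finally have log_card: "log 2 (real (card (cstates sim))) \<le> 4 + log 2 ?T" .
  have "0 \<le> log 2 ?T" using T by simp
  \<comment> \<open>As \<open>k \<ge> 2\<close>, the additive 4 is at most twice
    \<open>log 2 (2 * real k)\<close>, whence the factor 3; with the time factor 12 it gives
    36.\<close>
  then have space: "space sim \<le> 3 * (log 2 ?T + log 2 (2 * real k))"
    using log_card k2 by (simp add: space_def sim_simps(1))
  have "0 \<le> log 2 (real (card (cstates sim)))" using card by simp
  then have space0: "0 \<le> space sim" using k2 by (simp add: space_def sim_simps(1))
  have "TS sim \<le> ereal (12 * ?T) * ereal (space sim)"
    unfolding TS_def using run_time_sim_le space0 by (intro ereal_mult_right_mono) auto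
  also have "\<dots> = ereal (12 * ?T * space sim)" by simp
  also have "12 * ?T * space sim \<le> 12 * ?T * (3 * (log 2 ?T + log 2 (2 * real k)))"
    using space T by (intro mult_left_mono) auto
  finally show ?thesis by (simp add: mult_ac)
qed

lemma TS_sim_linear:
  assumes "real t \<le> c * real n"
  shows "TS sim \<le> ereal (36 * (2 + \<bar>log 2 c\<bar>) *
    (real t * real n * (log 2 (real n) + log 2 (real k))))"
proof -
  have n: "1 \<le> real n" and t1: "1 \<le> real t" and k: "2 \<le> real k"
    using n_ge_1 t k_ge_2 by auto
  then have c: "0 < c" using assms by (smt (verit) mult_nonpos_nonneg)
  let ?l = "log 2 (real n) + log 2 (real k)"
  have "log 2 (real t * real n) \<le> log 2 (c * (real n * real n))"
    using assms n t1 c by (subst log_le_cancel_iff) (auto simp flip: mult.assoc intro!: mult_right_mono)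
  also have "\<dots> = log 2 c + 2 * log 2 (real n)"
    using n c by (simp add: log_mult)
  finally have tn: "log 2 (real t * real n) \<le> log 2 c + 2 * log 2 (real n)" .
  have "log 2 2 \<le> log 2 (real k)" using k by (subst log_le_cancel_iff) auto
  then have lk: "1 \<le> log 2 (real k)" by simp
  have ln: "0 \<le> log 2 (real n)" using n by simp
  \<comment> \<open>The sum \<open>?l\<close> is at least 1 because \<open>k \<ge> 2\<close>, so a
    multiple of it absorbs the constant depending on \<open>c\<close>.\<close>
  have "\<bar>log 2 c\<bar> * 1 \<le> \<bar>log 2 c\<bar> * ?l" using lk ln by (intro mult_left_mono) auto
  moreover have "log 2 (2 * real k) = 1 + log 2 (real k)" using k by (simp add: log_mult)
  ultimately have "log 2 (real t * real n) + log 2 (2 * real k) \<le> (2 + \<bar>log 2 c\<bar>) * ?l"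
    using tn lk by (simp add: algebra_simps)
  then have "real t * real n * (log 2 (real t * real n) + log 2 (2 * real k))
      \<le> real t * real n * ((2 + \<bar>log 2 c\<bar>) * ?l)"
    by (intro mult_left_mono) auto
  then have "36 * (real t * real n * (log 2 (real t * real n) + log 2 (2 * real k)))
      \<le> 36 * (real t * real n * ((2 + \<bar>log 2 c\<bar>) * ?l))"
    by (rule mult_left_mono) simp
  also have "\<dots> = 36 * (2 + \<bar>log 2 c\<bar>) * (real t * real n * ?l)"
    by (simp only: mult_ac)
  finally have "36 * (real t * real n * (log 2 (real t * real n) + log 2 (2 * real k)))
      \<le> 36 * (2 + \<bar>log 2 c\<bar>) * (real t * real n * ?l)" .
  then show ?thesis using TS_sim by (meson ereal_less_eq(3) order_trans)
qed

end

theorem theorem5: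
  shows "\<exists>(C :: real) (D :: real \<Rightarrow> real).
    \<forall>(n :: nat) (k :: nat) (t :: nat) (\<epsilon> :: real) (h :: bool list \<Rightarrow> bool)
      (g :: bool \<Rightarrow> bool \<Rightarrow> bool) (A :: query_alg).
      t \<ge> 1 \<longrightarrow> query_algorithm n k t A \<longrightarrow> computes A n t h \<epsilon> \<longrightarrow>
      (\<exists>M :: (nat, sym) qcfa.
         is_2qcfa M \<and>
         recognizes M (L_lang (compose_bitwise h g) n) \<epsilon> \<and>
         qdim M = 2 * k \<and>
         real (card (cstates M)) \<le> C * (real t * real n) \<and>
         ereal_of_enat (run_time M) \<le> ereal (C * (real t * real n)) \<and>
         TS M \<le> ereal (C * (real t * real n *
           (log 2 (real t * real n) + log 2 (2 * real k)))) \<and>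
         (\<forall>c :: real. real t \<le> c * real n \<longrightarrow>
           TS M \<le> ereal (D c * (real t * real n * (log 2 (real n) + log 2 (real k))))))"
proof (intro exI[of _ 36] exI[of _ "\<lambda>c. 36 * (2 + \<bar>log 2 c\<bar>)"] allI impI)
  fix n k t :: nat and \<epsilon> :: real and h :: "bool list \<Rightarrow> bool" and g :: "bool \<Rightarrow> bool \<Rightarrow> bool"
    and A :: query_alg
  assume t: "t \<ge> 1" and alg: "query_algorithm n k t A" and comp: "computes A n t h \<epsilon>"
  obtain W where W: "unitary k W" "W *\<^sub>v unit_vec k 0 = start A"
    using exists_unitary_first_column[of "start A" k] alg by (auto simp: query_algorithm_def)
  interpret query_simulation n k t g A W by unfold_locales (fact alg W t)+
  \<comment> \<open>States and time satisfy the bound with 12; the common constant 36 comes from the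
    TS bound.\<close>
  have le: "12 * (real t * real n) \<le> 36 * (real t * real n)" by simp
  show "\<exists>M :: (nat, sym) qcfa.
         is_2qcfa M \<and>
         recognizes M (L_lang (compose_bitwise h g) n) \<epsilon> \<and>
         qdim M = 2 * k \<and>
         real (card (cstates M)) \<le> 36 * (real t * real n) \<and>
         ereal_of_enat (run_time M) \<le> ereal (36 * (real t * real n)) \<and>
         TS M \<le> ereal (36 * (real t * real n *
           (log 2 (real t * real n) + log 2 (2 * real k)))) \<and>
         (\<forall>c :: real. real t \<le> c * real n \<longrightarrow>
           TS M \<le> ereal (36 * (2 + \<bar>log 2 c\<bar>) *
             (real t * real n * (log 2 (real n) + log 2 (real k)))))"
  proof (intro exI[of _ sim] conjI allI impI)
    show "real (card (cstates sim)) \<le> 36 * (real t * real n)"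
      using card_cstates_sim le by (rule order_trans)
    show "ereal_of_enat (run_time sim) \<le> ereal (36 * (real t * real n))"
      by (rule order_trans[OF run_time_sim_le]) (use le in simp)
  qed (fact is_2qcfa_sim recognizes_sim[OF comp] sim_simps(1) TS_sim TS_sim_linear)+
qed

end
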